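(* Let $\mathbf{k}$ be a commutative ring with unit. For all $S,T\in H_{\rm LR}^{\epsilon}$, one has $$\Delta_{\rm LR}^{\epsilon}(S\backslash T)=S\backslash\Delta_{\rm LR}^{\epsilon}(T)+\Delta_{\rm LR}^{\epsilon}(S)\backslash T.$$
   Context: All modules, tensor products and linear maps are over $\mathbf{k}$. Planar binary trees: a planar binary tree is a finite rooted planar tree in which every internal vertex has exactly two ordered incoming branches (left and right). The trivial tree, with no internal vertices, is denoted $|$. Let $\mathcal{Y}$ be the set of planar binary trees and $H_{\rm LR}^{\epsilon}:=\mathbf{k}\mathcal{Y}$ the free $\mathbf{k}$-module on it. Grafting: for $T_l,T_r\in\mathcal{Y}$, $T_l\vee T_r$ is the tree obtained by creating a new root with left branch $T_l$ and right branch $T_r$; $\vee$ is extended bilinearly. Every $T\in\mathcal{Y}$ with $T\neq |$ is uniquely of the form $T=T_l\vee T_r$. Under product: the bilinear map $\backslash$ on $H_{\rm LR}^{\epsilon}$ where, for trees $S,T$, $S\backslash T$ is obtained by adjoining the root of $T$ to the rightmost branch of $S$; recursively, $|\backslash T=T$ and $(S_l\vee S_r)\backslash T=S_l\vee(S_r\backslash T)$. It is associative with unit $|$. Actions on $H_{\rm LR}^{\epsilon}\otimes H_{\rm LR}^{\epsilon}$: $U\backslash(V\otimes W):=(U\backslash V)\otimes W$ and $(U\otimes V)\backslash W:=U\otimes(V\backslash W)$, extended linearly. Infinitesimal coproduct: the linear map $\Delta_{\rm LR}^{\epsilon}:H_{\rm LR}^{\epsilon}\to H_{\rm LR}^{\epsilon}\otimes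 H_{\rm LR}^{\epsilon}$ defined on trees recursively by $\Delta_{\rm LR}^{\epsilon}(|)=0$ and $$\Delta_{\rm LR}^{\epsilon}(T_l\vee T_r)=T_l\otimes T_r+(\mathrm{id}\otimes\vee)(\Delta_{\rm LR}^{\epsilon}(T_l)\otimes T_r)+(\vee\otimes\mathrm{id})(T_l\otimes\Delta_{\rm LR}^{\epsilon}(T_r)).$$ *)

theory Defs
  imports "HOL-Library.Poly_Mapping"
begin

section \<open>Free modules and their tensor products\<close>

text \<open>
  The free module on a set is the type of finitely supported functions. The sort
  \<open>{comm_ring, comm_monoid_mult}\<close> says precisely \<open>commutative ring with unit\<close>:
  unlike the class \<open>comm_ring_1\<close>, it does not exclude the zero ring.
\<close>

definition smul :: "'k::{comm_ring,comm_monoid_mult} \<Rightarrow> ('a \<Rightarrow>\<^sub>0 'k) \<Rightarrow> ('a \<Rightarrow>\<^sub>0 'k)"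
  where "smul c x = Poly_Mapping.map ((*) c) x"

abbreviation basis :: "'a \<Rightarrow> ('a \<Rightarrow>\<^sub>0 'k::{comm_ring,comm_monoid_mult})"
  where "basis a \<equiv> Poly_Mapping.single a 1"

definition lin_ext ::
  "('a \<Rightarrow> ('b \<Rightarrow>\<^sub>0 'k)) \<Rightarrow> ('a \<Rightarrow>\<^sub>0 'k::{comm_ring,comm_monoid_mult}) \<Rightarrow> ('b \<Rightarrow>\<^sub>0 'k)"
  where "lin_ext f x = (\<Sum>a\<in>Poly_Mapping.keys x. smul (Poly_Mapping.lookup x a) (f a))"

definition bilin_ext ::
  "('a \<Rightarrow> 'b \<Rightarrow> ('c \<Rightarrow>\<^sub>0 'k)) \<Rightarrow>
   ('a \<Rightarrow>\<^sub>0 'k::{comm_ring,comm_monoid_mult}) \<Rightarrow> ('b \<Rightarrow>\<^sub>0 'k) \<Rightarrow> ('c \<Rightarrow>\<^sub>0 'k)"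
  where "bilin_ext f x y = lin_ext (\<lambda>a. lin_ext (f a) y) x"

text \<open>
  The tensor product of the free modules on \<open>'a\<close> and \<open>'b\<close> is realised as the free module on
  \<open>'a \<times> 'b\<close>; its universal property is proved below as \<open>tensor_universal\<close>.
\<close>

definition tensor ::
  "('a \<Rightarrow>\<^sub>0 'k::{comm_ring,comm_monoid_mult}) \<Rightarrow> ('b \<Rightarrow>\<^sub>0 'k) \<Rightarrow> ('a \<times> 'b \<Rightarrow>\<^sub>0 'k)"
  (infixr "\<otimes>" 75)
  where "x \<otimes> y = bilin_ext (\<lambda>a b. basis (a, b)) x y"

definition tensor_map ::
  "(('a \<Rightarrow>\<^sub>0 'k) \<Rightarrow> ('c \<Rightarrow>\<^sub>0 'k)) \<Rightarrow> (('b \<Rightarrow>\<^sub>0 'k) \<Rightarrow> ('d \<Rightarrow>\<^sub>0 'k)) \<Rightarrow>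
   ('a \<times> 'b \<Rightarrow>\<^sub>0 'k::{comm_ring,comm_monoid_mult}) \<Rightarrow> ('c \<times> 'd \<Rightarrow>\<^sub>0 'k)"
  where "tensor_map f g = lin_ext (\<lambda>(a, b). f (basis a) \<otimes> g (basis b))"

definition assoc_right ::
  "(('a \<times> 'b) \<times> 'c \<Rightarrow>\<^sub>0 'k::{comm_ring,comm_monoid_mult}) \<Rightarrow> ('a \<times> 'b \<times> 'c \<Rightarrow>\<^sub>0 'k)"
  where "assoc_right = lin_ext (\<lambda>((a, b), c). basis (a, b, c))"

definition assoc_left ::
  "('a \<times> 'b \<times> 'c \<Rightarrow>\<^sub>0 'k::{comm_ring,comm_monoid_mult}) \<Rightarrow> (('a \<times> 'b) \<times> 'c \<Rightarrow>\<^sub>0 'k)"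
  where "assoc_left = lin_ext (\<lambda>(a, b, c). basis ((a, b), c))"

lemma lookup_smul [simp]: "Poly_Mapping.lookup (smul c x) a = c * Poly_Mapping.lookup x a"
  by (simp add: smul_def map.rep_eq when_def)

lemma smul_zero_left [simp]: "smul 0 x = 0"
  and smul_one [simp]: "smul 1 x = x"
  and smul_zero_right [simp]: "smul c 0 = 0"
  and smul_add_left: "smul (c + d) x = smul c x + smul d x"
  and smul_add_right: "smul c (x + y) = smul c x + smul c y"
  and smul_smul: "smul c (smul d x) = smul (c * d) x"
  by (auto intro!: poly_mapping_eqI simp: lookup_add algebra_simps)

lemma smul_basis: "smul c (basis a) = Poly_Mapping.single a c"
  by (auto intro!: poly_mapping_eqI simp: lookup_single when_def)

lemma smul_sum: "smul c (sum f A) = (\<Sum>a\<in>A. smul c (f a))"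
  by (induction A rule: infinite_finite_induct) (auto simp: smul_add_right)

lemma lin_ext_superset:
  assumes "finite A" "Poly_Mapping.keys x \<subseteq> A"
  shows "lin_ext f x = (\<Sum>a\<in>A. smul (Poly_Mapping.lookup x a) (f a))"
  unfolding lin_ext_def using assms
  by (intro sum.mono_neutral_left) (auto simp: in_keys_iff)

lemma lin_ext_add: "lin_ext f (x + y) = lin_ext f x + lin_ext f y"
proof -
  let ?A = "Poly_Mapping.keys x \<union> Poly_Mapping.keys y"
  have "Poly_Mapping.keys (x + y) \<subseteq> ?A"
    by (rule Poly_Mapping.keys_add)
  then show ?thesis
    by (simp add: lin_ext_superset[of ?A] lookup_add smul_add_left sum.distrib)
qed

lemma lin_ext_smul: "lin_ext f (smul c x) = smul c (lin_ext f x)"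
proof -
  have "Poly_Mapping.keys (smul c x) \<subseteq> Poly_Mapping.keys x"
    by (auto simp: in_keys_iff)
  then show ?thesis
    by (simp add: lin_ext_superset[of "Poly_Mapping.keys x"] smul_sum smul_smul)
qed

lemma lin_ext_zero [simp]: "lin_ext f 0 = 0"
  by (simp add: lin_ext_def)

lemma lin_ext_single: "lin_ext f (Poly_Mapping.single a c) = smul c (f a)"
  by (subst lin_ext_superset[of "{a}"]) auto

lemma lin_ext_basis [simp]: "lin_ext f (basis a) = f a"
  by (simp add: lin_ext_single)

lemma free_induct:
  fixes x :: "'a \<Rightarrow>\<^sub>0 'k::{comm_ring,comm_monoid_mult}"
  assumes "P 0" "\<And>a. P (basis a)" "\<And>c y. P y \<Longrightarrow> P (smul c y)"
    and "\<And>y z. P y \<Longrightarrow> P z \<Longrightarrow> P (y + z)"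
  shows "P x"
proof (induction x rule: update_induct)
  case const
  then show ?case by (rule assms(1))
next
  case (update x a c)
  have "Poly_Mapping.update a c x = x + smul c (basis a)"
    using update(1)
    by (intro poly_mapping_eqI)
       (auto simp: lookup_update lookup_add lookup_single when_def in_keys_iff)
  then show ?case
    using update assms by metis
qed

lemma lin_ext_fun_add: "lin_ext (\<lambda>a. f a + g a) x = lin_ext f x + lin_ext g x"
  by (simp add: lin_ext_def smul_add_right sum.distrib)

lemma lin_ext_fun_smul: "lin_ext (\<lambda>a. smul c (f a)) x = smul c (lin_ext f x)"
  by (simp add: lin_ext_def smul_sum smul_smul mult.commute)

lemma bilin_ext_add_left: "bilin_ext f (x + x') y = bilin_ext f x y + bilin_ext f x' y"
  and bilin_ext_add_right: "bilin_ext f x (y + y') = bilin_ext f x y + bilin_ext f x y'"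
  and bilin_ext_smul_left: "bilin_ext f (smul c x) y = smul c (bilin_ext f x y)"
  and bilin_ext_smul_right: "bilin_ext f x (smul c y) = smul c (bilin_ext f x y)"
  and bilin_ext_basis [simp]: "bilin_ext f (basis a) (basis b) = f a b"
  by (simp_all add: bilin_ext_def lin_ext_add lin_ext_smul lin_ext_fun_add lin_ext_fun_smul)

lemmas tensor_add_left = bilin_ext_add_left[of "\<lambda>a b. basis (a, b)", folded tensor_def]
lemmas tensor_add_right = bilin_ext_add_right[of "\<lambda>a b. basis (a, b)", folded tensor_def]
lemmas tensor_smul_left = bilin_ext_smul_left[of "\<lambda>a b. basis (a, b)", folded tensor_def]
lemmas tensor_smul_right = bilin_ext_smul_right[of "\<lambda>a b. basis (a, b)", folded tensor_def]

lemma tensor_basis [simp]: "basis a \<otimes> basis b = basis (a, b)"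
  by (simp add: tensor_def)

lemma tensor_zero [simp]: "0 \<otimes> y = 0" "x \<otimes> 0 = 0"
  using tensor_smul_left[of 0 0 y] tensor_smul_right[of x 0 0] by simp_all

theorem tensor_universal:
  fixes s :: "'k::{comm_ring,comm_monoid_mult} \<Rightarrow> 'm::ab_group_add \<Rightarrow> 'm"
    and B :: "('a \<Rightarrow>\<^sub>0 'k) \<Rightarrow> ('b \<Rightarrow>\<^sub>0 'k) \<Rightarrow> 'm"
  assumes s: "\<And>c u v. s c (u + v) = s c u + s c v" "\<And>c d u. s (c + d) u = s c u + s d u"
    "\<And>c d u. s c (s d u) = s (c * d) u" "\<And>u. s 1 u = u"
    and B: "\<And>x x' y. B (x + x') y = B x y + B x' y" "\<And>x y y'. B x (y + y') = B x y + B x y'"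
    "\<And>c x y. B (smul c x) y = s c (B x y)" "\<And>c x y. B x (smul c y) = s c (B x y)"
  shows "\<exists>!F. (\<forall>z z'. F (z + z') = F z + F z') \<and> (\<forall>c z. F (smul c z) = s c (F z)) \<and>
              (\<forall>x y. F (x \<otimes> y) = B x y)"
proof (rule ex_ex1I)
  have s0 [simp]: "s 0 u = 0" for u using s(2)[of 0 0 u] by simp
  have s0' [simp]: "s c 0 = 0" for c using s(1)[of c 0 0] by simp
  have B0 [simp]: "B 0 y = 0" "B x 0 = 0" for x y
    using B(1)[of 0 0 y] B(2)[of x 0 0] by simp_all
  define F where "F z = (\<Sum>p\<in>Poly_Mapping.keys z.
      s (Poly_Mapping.lookup z p) (B (basis (fst p)) (basis (snd p))))" for z
  have F: "F z = (\<Sum>p\<in>A. s (Poly_Mapping.lookup z p) (B (basis (fst p)) (basis (snd p))))"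
    if "finite A" "Poly_Mapping.keys z \<subseteq> A" for z A
    unfolding F_def using that by (intro sum.mono_neutral_left) (auto simp: in_keys_iff)
  have add: "F (z + z') = F z + F z'" for z z'
    using Poly_Mapping.keys_add[of z z']
    by (simp add: F[of "Poly_Mapping.keys z \<union> Poly_Mapping.keys z'"] lookup_add s sum.distrib)
  have s_sum: "s c (sum f A) = (\<Sum>a\<in>A. s c (f a))" for c and f :: "'a \<times> 'b \<Rightarrow> 'm" and A
    by (induction A rule: infinite_finite_induct) (auto simp: s)
  have smul: "F (smul c z) = s c (F z)" for c z
  proof -
    have "Poly_Mapping.keys (smul c z) \<subseteq> Poly_Mapping.keys z"
      by (auto simp: in_keys_iff)
    then show ?thesis
      by (simp add: F[of "Poly_Mapping.keys z"] s_sum s(3))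
  qed
  have bas: "F (basis p) = B (basis (fst p)) (basis (snd p))" for p
    by (subst F[of "{p}"]) (auto simp: s)
  have 0: "F 0 = 0" by (simp add: F_def)
  have *: "F (basis a \<otimes> y) = B (basis a) y" for a y
    by (induction y rule: free_induct)
       (auto simp: 0 bas tensor_add_right tensor_smul_right add smul B)
  have "F (x \<otimes> y) = B x y" for x y
    by (induction x rule: free_induct)
       (auto simp: 0 * tensor_add_left tensor_smul_left add smul B)
  then show "\<exists>F. (\<forall>z z'. F (z + z') = F z + F z') \<and> (\<forall>c z. F (smul c z) = s c (F z)) \<and>
                 (\<forall>x y. F (x \<otimes> y) = B x y)"
    using add smul by blast
next
  fix F G :: "('a \<times> 'b \<Rightarrow>\<^sub>0 'k) \<Rightarrow> 'm"
  assume F: "(\<forall>z z'. F (z + z') = F z + F z') \<and> (\<forall>c z. F (smul c z) = s c (F z)) \<and>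
             (\<forall>x y. F (x \<otimes> y) = B x y)"
    and G: "(\<forall>z z'. G (z + z') = G z + G z') \<and> (\<forall>c z. G (smul c z) = s c (G z)) \<and>
             (\<forall>x y. G (x \<otimes> y) = B x y)"
  have "F z = G z" for z
  proof (induction z rule: free_induct)
    case 1
    have "F (0 + 0) = F 0 + F 0" "G (0 + 0) = G 0 + G 0" using F G by blast+
    then show ?case by simp
  next
    case (2 p)
    have "basis p = (basis (fst p) \<otimes> basis (snd p) :: _ \<Rightarrow>\<^sub>0 'k)" by simp
    then show ?case using F G by metis
  qed (use F G in auto)
  then show "F = G" ..
qed

lemma tensor_map_tensor:
  assumes "\<And>x x'. f (x + x') = f x + f x'" "\<And>c x. f (smul c x) = smul c (f x)"
    and "\<And>y y'. g (y + y') = g y + g y'" "\<And>c y. g (smul c y) = smul c (g y)"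
  shows "tensor_map f g (x \<otimes> y) = f x \<otimes> g y"
proof -
  have [simp]: "f 0 = 0" "g 0 = 0"
    using assms(2)[of 0 0] assms(4)[of 0 0] by simp_all
  have *: "tensor_map f g (basis a \<otimes> y) = f (basis a) \<otimes> g y" for a y
    by (induction y rule: free_induct)
       (auto simp: tensor_map_def assms tensor_add_right tensor_smul_right lin_ext_add lin_ext_smul)
  show ?thesis
    by (induction x rule: free_induct)
       (use * in \<open>auto simp: tensor_map_def assms tensor_add_left tensor_smul_left
          lin_ext_add lin_ext_smul\<close>)
qed

section \<open>Planar binary trees\<close>

datatype pbt = Triv | Node (left_branch: pbt) (right_branch: pbt)

type_synonym 'k H_LR = "pbt \<Rightarrow>\<^sub>0 'k"
type_synonym 'k H_LR2 = "pbt \<times> pbt \<Rightarrow>\<^sub>0 'k"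

text \<open>The bilinear extension of grafting, as a linear map on the tensor square.\<close>

definition vee :: "'k::{comm_ring,comm_monoid_mult} H_LR2 \<Rightarrow> 'k H_LR"
  where "vee = lin_ext (\<lambda>(S, T). basis (Node S T))"

primrec under_tree :: "pbt \<Rightarrow> pbt \<Rightarrow> pbt" where
  "under_tree Triv T = T"
| "under_tree (Node Sl Sr) T = Node Sl (under_tree Sr T)"

definition under :: "'k::{comm_ring,comm_monoid_mult} H_LR \<Rightarrow> 'k H_LR \<Rightarrow> 'k H_LR"
  (infixl "\<setminus>" 70)
  where "x \<setminus> y = bilin_ext (\<lambda>S T. basis (under_tree S T)) x y"

definition left_act :: "'k::{comm_ring,comm_monoid_mult} H_LR \<Rightarrow> 'k H_LR2 \<Rightarrow> 'k H_LR2"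
  (infixl "\<setminus>\<^sub>l" 70)
  where "u \<setminus>\<^sub>l z = lin_ext (\<lambda>(V, W). (u \<setminus> basis V) \<otimes> basis W) z"

definition right_act :: "'k::{comm_ring,comm_monoid_mult} H_LR2 \<Rightarrow> 'k H_LR \<Rightarrow> 'k H_LR2"
  (infixl "\<setminus>\<^sub>r" 70)
  where "z \<setminus>\<^sub>r w = lin_ext (\<lambda>(U, V). basis U \<otimes> (basis V \<setminus> w)) z"

primrec Delta_tree :: "pbt \<Rightarrow> 'k::{comm_ring,comm_monoid_mult} H_LR2" where
  "Delta_tree Triv = 0"
| "Delta_tree (Node Tl Tr) =
     basis Tl \<otimes> basis Tr
     + tensor_map id vee (assoc_right (Delta_tree Tl \<otimes> basis Tr))
     + tensor_map vee id (assoc_left (basis Tl \<otimes> Delta_tree Tr))"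

definition Delta_LR :: "'k::{comm_ring,comm_monoid_mult} H_LR \<Rightarrow> 'k H_LR2"
  where "Delta_LR = lin_ext Delta_tree"

lemmas under_add_left =
  bilin_ext_add_left[of "\<lambda>S T. basis (under_tree S T)", folded under_def]
lemmas under_add_right =
  bilin_ext_add_right[of "\<lambda>S T. basis (under_tree S T)", folded under_def]
lemmas under_smul_left =
  bilin_ext_smul_left[of "\<lambda>S T. basis (under_tree S T)", folded under_def]
lemmas under_smul_right =
  bilin_ext_smul_right[of "\<lambda>S T. basis (under_tree S T)", folded under_def]

lemma left_act_tensor: "u \<setminus>\<^sub>l (v \<otimes> w) = (u \<setminus> v) \<otimes> w"
proof -
  have "u \<setminus>\<^sub>l z = tensor_map ((\<setminus>) u) id z" for z
    by (simp add: left_act_def tensor_map_def)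
  then show ?thesis
    by (simp add: tensor_map_tensor under_add_right under_smul_right)
qed

lemma right_act_tensor: "(u \<otimes> v) \<setminus>\<^sub>r w = u \<otimes> (v \<setminus> w)"
proof -
  have "z \<setminus>\<^sub>r w = tensor_map id (\<lambda>v. v \<setminus> w) z" for z
    by (simp add: right_act_def tensor_map_def)
  then show ?thesis
    by (simp add: tensor_map_tensor under_add_left under_smul_left)
qed

end

theory Submission
  imports Defs
begin

text \<open>
  Both sides of the identity are bilinear, so it suffices to prove it for trees, and there it
  holds by structural induction on \<open>S\<close>, for a fixed tree \<open>T\<close>. For \<open>S = |\<close> the term
  \<open>\<Delta>(S) \ T\<close> vanishes and \<open>S\<close> acts as the identity. For \<open>S = L \<or> R\<close> one has
  \<open>S \ T = L \<or> (R \ T)\<close>, so the recursion for \<open>\<Delta>\<close> together with the induction hypothesis for \<open>R\<close>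
  yields four terms:

  \<^item> \<open>L \<otimes> (R \ T)\<close>, which is \<open>(L \<otimes> R) \ T\<close>;
  \<^item> \<open>\<Delta>(L)\<close> with \<open>R \ T\<close> grafted on the right of the second tensor factor, which is what one
    gets by grafting \<open>R\<close> first and then letting \<open>T\<close> act on the right;
  \<^item> \<open>\<Delta>(R) \ T\<close> with \<open>L\<close> grafted on the left of the first factor; the action of \<open>T\<close> changes the
    second factor only, so it may be performed after the grafting;
  \<^item> \<open>R \ \<Delta>(T)\<close> with \<open>L\<close> grafted on the left of the first factor, which is \<open>(L \<or> R) \ \<Delta>(T)\<close>.

  The first three add up to \<open>\<Delta>(S) \ T\<close>. Each of the last three rewritings says that two
  compositions of linear maps agree on pairs of trees, where they move the same branches. The
  maps involved are therefore first written as linear extensions of maps on pairs of trees.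
\<close>

lemma lin_ext_lin_ext: "lin_ext g (lin_ext f x) = lin_ext (\<lambda>a. lin_ext g (f a)) x"
  by (induction x rule: free_induct) (simp_all add: lin_ext_add lin_ext_smul)

text \<open>
  The two grafting operators through which \<open>Delta_tree\<close> recurses, in coordinates: the detour
  through the triple tensor product just adds one branch to one of the two factors.
\<close>

lemma graft_second_factor:
  "tensor_map id vee (assoc_right (z \<otimes> basis R)) = lin_ext (\<lambda>(U, V). basis (U, Node V R)) z"
  by (induction z rule: free_induct)
     (auto simp: tensor_map_def assoc_right_def vee_def tensor_add_left tensor_smul_left
        lin_ext_add lin_ext_smul)

lemma graft_first_factor:
  "tensor_map vee id (assoc_left (basis L \<otimes> z)) = lin_ext (\<lambda>(U, V). basis (Node L U, V)) z"
  by (induction z rule: free_induct)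
     (auto simp: tensor_map_def assoc_left_def vee_def tensor_add_right tensor_smul_right
        lin_ext_add lin_ext_smul)

lemma under_basis: "basis S \<setminus> basis T = basis (under_tree S T)"
  by (simp add: under_def)

lemma left_act_basis:
  "basis S \<setminus>\<^sub>l z = lin_ext (\<lambda>(V, W). basis (under_tree S V, W)) z"
  by (simp add: left_act_def under_basis)

lemma right_act_basis:
  "z \<setminus>\<^sub>r basis T = lin_ext (\<lambda>(U, V). basis (U, under_tree V T)) z"
  by (simp add: right_act_def under_basis)

lemma left_act_zero_right: "u \<setminus>\<^sub>l 0 = 0"
  and left_act_add_right: "u \<setminus>\<^sub>l (z + z') = u \<setminus>\<^sub>l z + u \<setminus>\<^sub>l z'"
  and left_act_smul_right: "u \<setminus>\<^sub>l smul c z = smul c (u \<setminus>\<^sub>l z)"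
  by (simp_all add: left_act_def lin_ext_add lin_ext_smul)

lemma left_act_add_left: "(u + u') \<setminus>\<^sub>l z = u \<setminus>\<^sub>l z + u' \<setminus>\<^sub>l z"
  and left_act_smul_left: "smul c u \<setminus>\<^sub>l z = smul c (u \<setminus>\<^sub>l z)"
  by (simp_all add: left_act_def under_add_left under_smul_left tensor_add_left tensor_smul_left
      case_prod_unfold lin_ext_fun_add lin_ext_fun_smul)

lemma right_act_zero_left: "0 \<setminus>\<^sub>r w = 0"
  and right_act_add_left: "(z + z') \<setminus>\<^sub>r w = z \<setminus>\<^sub>r w + z' \<setminus>\<^sub>r w"
  and right_act_smul_left: "smul c z \<setminus>\<^sub>r w = smul c (z \<setminus>\<^sub>r w)"
  by (simp_all add: right_act_def lin_ext_add lin_ext_smul)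

lemma right_act_add_right: "z \<setminus>\<^sub>r (w + w') = z \<setminus>\<^sub>r w + z \<setminus>\<^sub>r w'"
  and right_act_smul_right: "z \<setminus>\<^sub>r smul c w = smul c (z \<setminus>\<^sub>r w)"
  by (simp_all add: right_act_def under_add_right under_smul_right tensor_add_right
      tensor_smul_right case_prod_unfold lin_ext_fun_add lin_ext_fun_smul)

lemma left_act_Triv: "basis Triv \<setminus>\<^sub>l z = z"
  by (induction z rule: free_induct) (auto simp: left_act_basis lin_ext_add lin_ext_smul)

text \<open>The induction on \<open>S\<close>, in which the four terms above are matched up.\<close>

lemma Delta_tree_under_tree:
  "Delta_tree (under_tree S T) = basis S \<setminus>\<^sub>l Delta_tree T + Delta_tree S \<setminus>\<^sub>r basis T"
proof (induction S)
  case Triv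
  then show ?case
    by (simp add: left_act_Triv right_act_zero_left)
next
  case (Node L R)
  let ?graft_L = "lin_ext (\<lambda>(U, V). basis (Node L U, V))"
  let ?graft_R = "lin_ext (\<lambda>(U, V). basis (U, Node V R))"
  have right_R: "lin_ext (\<lambda>(U, V). basis (U, Node V (under_tree R T))) z = ?graft_R z \<setminus>\<^sub>r basis T"
    for z
    by (simp add: right_act_basis lin_ext_lin_ext case_prod_unfold)
  have right_L: "?graft_L (z \<setminus>\<^sub>r basis T) = ?graft_L z \<setminus>\<^sub>r basis T" for z
    by (simp add: right_act_basis lin_ext_lin_ext case_prod_unfold)
  have left_L: "?graft_L (basis R \<setminus>\<^sub>l z) = basis (Node L R) \<setminus>\<^sub>l z" for z
    by (simp add: left_act_basis lin_ext_lin_ext case_prod_unfold)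
  have root: "basis (L, under_tree R T) = basis (L, R) \<setminus>\<^sub>r basis T"
    by (simp add: right_act_basis)
  show ?case
    by (simp add: Node.IH graft_second_factor graft_first_factor lin_ext_add right_act_add_left
        right_R right_L left_L root add_ac)
qed

theorem lemma2p7:
  fixes S T :: "'k::{comm_ring,comm_monoid_mult} H_LR"
  shows "Delta_LR (S \<setminus> T) = S \<setminus>\<^sub>l Delta_LR T + Delta_LR S \<setminus>\<^sub>r T"
proof -
  have Delta: "Delta_LR 0 = 0" "Delta_LR (x + y) = Delta_LR x + Delta_LR y"
    "Delta_LR (smul c x) = smul c (Delta_LR x)" "Delta_LR (basis t) = Delta_tree t"
    for x y :: "'k H_LR" and c t
    by (simp_all add: Delta_LR_def lin_ext_add lin_ext_smul)
  have zero: "x \<setminus> 0 = 0" "0 \<setminus> x = 0" "0 \<setminus>\<^sub>l z = 0" "z \<setminus>\<^sub>r 0 = 0"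
    for x :: "'k H_LR" and z :: "'k H_LR2"
    using under_smul_right[of x 0 0] under_smul_left[of 0 0 x] left_act_smul_left[of 0 0 z]
      right_act_smul_right[of z 0 0]
    by simp_all
  have tree: "Delta_LR (basis s \<setminus> T) = basis s \<setminus>\<^sub>l Delta_LR T + Delta_LR (basis s) \<setminus>\<^sub>r T" for s
    by (induction T rule: free_induct)
       (simp_all add: Delta zero left_act_zero_right under_basis Delta_tree_under_tree
          under_add_right under_smul_right left_act_add_right left_act_smul_right
          right_act_add_right right_act_smul_right smul_add_right add_ac)
  show ?thesis
    by (induction S rule: free_induct)
       (simp_all add: tree Delta(1-3) zero right_act_zero_left
          under_add_left under_smul_left left_act_add_left left_act_smul_left
          right_act_add_left right_act_smul_left smul_add_right add_ac)
qed

end
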